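(* Let $\Gamma$ be a vertex-transitive graph of order $n$. Then $\Gamma$ is CIS if and only if all maximal stable sets of $\Gamma$ are of size $\alpha(\Gamma)$, all maximal cliques of $\Gamma$ are of size $\omega(\Gamma)$, and $\alpha(\Gamma)\,\omega(\Gamma)=n$.
   Context: All graphs are finite, simple and undirected (with non-empty vertex set). A clique (respectively, stable set) is a set of pairwise adjacent (respectively, pairwise non-adjacent) vertices; "maximal" means maximal with respect to inclusion. $\omega(\Gamma)$ and $\alpha(\Gamma)$ denote the largest cardinality of a clique and of a stable set of $\Gamma$, respectively. A graph is CIS if every maximal stable set and every maximal clique have non-empty intersection. A graph is vertex-transitive if for every pair of vertices there is an automorphism of the graph mapping one to the other. The order of a graph is its number of vertices. *)

theory Defs
  imports "HOL-Library.Ramsey"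
begin

text \<open>
  A graph is a vertex set \<open>V\<close> together with a set \<open>E\<close> of two-element subsets of \<open>V\<close>.
  \<open>clique\<close> and \<open>indep\<close> are the library predicates; their first argument is the candidate set of
  vertices, not the vertex set of the graph, so containment in \<open>V\<close> is required separately.
\<close>

definition simple_graph :: "'a set \<Rightarrow> 'a set set \<Rightarrow> bool" where
  "simple_graph V E \<longleftrightarrow> finite V \<and> V \<noteq> {} \<and> E \<subseteq> [V]\<^bsup>2\<^esup>"

definition maximal_clique :: "'a set \<Rightarrow> 'a set set \<Rightarrow> 'a set \<Rightarrow> bool" where
  "maximal_clique V E C \<longleftrightarrow>
     C \<subseteq> V \<and> clique C E \<and> (\<forall>D. D \<subseteq> V \<and> clique D E \<and> C \<subseteq> D \<longrightarrow> D = C)"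

definition maximal_stable_set :: "'a set \<Rightarrow> 'a set set \<Rightarrow> 'a set \<Rightarrow> bool" where
  "maximal_stable_set V E S \<longleftrightarrow>
     S \<subseteq> V \<and> indep S E \<and> (\<forall>T. T \<subseteq> V \<and> indep T E \<and> S \<subseteq> T \<longrightarrow> T = S)"

definition clique_number :: "'a set \<Rightarrow> 'a set set \<Rightarrow> nat" where
  "clique_number V E = Max (card ` {C. C \<subseteq> V \<and> clique C E})"

definition stability_number :: "'a set \<Rightarrow> 'a set set \<Rightarrow> nat" where
  "stability_number V E = Max (card ` {S. S \<subseteq> V \<and> indep S E})"

definition CIS :: "'a set \<Rightarrow> 'a set set \<Rightarrow> bool" where
  "CIS V E \<longleftrightarrow>
     (\<forall>S C. maximal_stable_set V E S \<and> maximal_clique V E C \<longrightarrow> S \<inter> C \<noteq> {})"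

definition graph_automorphism :: "'a set \<Rightarrow> 'a set set \<Rightarrow> ('a \<Rightarrow> 'a) \<Rightarrow> bool" where
  "graph_automorphism V E f \<longleftrightarrow>
     bij_betw f V V \<and> (\<forall>u\<in>V. \<forall>v\<in>V. {f u, f v} \<in> E \<longleftrightarrow> {u, v} \<in> E)"

definition vertex_transitive :: "'a set \<Rightarrow> 'a set set \<Rightarrow> bool" where
  "vertex_transitive V E \<longleftrightarrow> (\<forall>u\<in>V. \<forall>v\<in>V. \<exists>f. graph_automorphism V E f \<and> f u = v)"

end

theory Submission
  imports Defs "HOL-Library.FuncSet"
begin

text \<open>
  Fix a clique \<open>C\<close> and a stable set \<open>S\<close>, and let \<open>g\<close> range over the automorphism group. By
  transitivity each vertex is mapped to each other vertex by the same number of automorphisms, so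
  \<open>g ` C\<close> meets \<open>S\<close> in \<open>|C| |S| / n\<close> vertices on average. As each intersection has at most
  one vertex, all of them are non-empty if and only if \<open>|C| |S| = n\<close>.
\<close>

section \<open>The finite set of automorphisms\<close>

text \<open>
  Since \<^const>\<open>graph_automorphism\<close> ignores the values outside the vertex set, restricting to
  extensional functions makes the set of automorphisms finite.
\<close>

definition automorphisms :: "'a set \<Rightarrow> 'a set set \<Rightarrow> ('a \<Rightarrow> 'a) set" where
  "automorphisms V E = {g \<in> extensional V. graph_automorphism V E g}"

lemma finite_automorphisms:
  assumes "finite V"
  shows "finite (automorphisms V E)"
proof (rule finite_subset)
  show "automorphisms V E \<subseteq> V \<rightarrow>\<^sub>E V"
    by (auto simp: automorphisms_def graph_automorphism_def PiE_def bij_betw_def)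
  show "finite (V \<rightarrow>\<^sub>E V)"
    using assms by (intro finite_PiE) auto
qed

lemma id_in_automorphisms: "restrict id V \<in> automorphisms V E"
proof -
  have "bij_betw (restrict id V) V V"
    by (subst bij_betw_cong[of V _ id]) auto
  then show ?thesis
    by (auto simp: automorphisms_def graph_automorphism_def)
qed

text \<open>Vertex-transitivity provides an \<open>h\<close> that need not be extensional. Composing
  with \<open>compose V\<close> keeps the result extensional, which plain composition could fail to
  do.\<close>

lemma compose_in_automorphisms:
  assumes "graph_automorphism V E h" and "g \<in> automorphisms V E"
  shows "compose V h g \<in> automorphisms V E"
proof -
  have g: "g u \<in> V" if "u \<in> V" for u
    using assms that by (auto simp: automorphisms_def graph_automorphism_def bij_betw_def)
  have "bij_betw (compose V h g) V V"
    using assms by (auto simp: automorphisms_def graph_automorphism_def intro: bij_betw_compose)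
  then show ?thesis
    using assms g by (auto simp: automorphisms_def graph_automorphism_def compose_eq)
qed

section \<open>Counting automorphisms by the image of a vertex\<close>

text \<open>Composition with an automorphism taking \<open>y\<close> to \<open>z\<close> is
  injective, since extensional functions agreeing on \<open>V\<close> are equal. As \<open>y\<close>
  and \<open>z\<close> are arbitrary, swapping them gives equality.\<close>

lemma card_automorphisms_mapping_le:
  assumes "finite V" and "vertex_transitive V E" and "x \<in> V" "y \<in> V" "z \<in> V"
  shows "card {g \<in> automorphisms V E. g x = y} \<le> card {g \<in> automorphisms V E. g x = z}"
proof -
  obtain h where h: "graph_automorphism V E h" "h y = z"
    using assms by (auto simp: vertex_transitive_def)
  show ?thesis
  proof (rule card_inj_on_le[where f = "compose V h"])
    show "inj_on (compose V h) {g \<in> automorphisms V E. g x = y}"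
    proof (rule inj_onI)
      fix g g'
      assume g: "g \<in> {g \<in> automorphisms V E. g x = y}" and g': "g' \<in> {g \<in> automorphisms V E. g x = y}"
        and eq: "compose V h g = compose V h g'"
      show "g = g'"
      proof (rule extensionalityI)
        fix v assume v: "v \<in> V"
        then have "h (g v) = h (g' v)"
          using eq by (metis compose_eq)
        moreover have "inj_on h V" "g v \<in> V" "g' v \<in> V"
          using h g g' v by (auto simp: automorphisms_def graph_automorphism_def bij_betw_def)
        ultimately show "g v = g' v"
          by (auto dest: inj_onD)
      qed (use g g' in \<open>auto simp: automorphisms_def\<close>)
    qed
    show "compose V h ` {g \<in> automorphisms V E. g x = y} \<subseteq> {g \<in> automorphisms V E. g x = z}"
      using h assms by (auto simp: compose_in_automorphisms compose_eq)
    show "finite {g \<in> automorphisms V E. g x = z}"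
      using finite_automorphisms[OF assms(1)] by simp
  qed
qed

lemma card_automorphisms_into:
  assumes "finite V" and "vertex_transitive V E" and "x \<in> V" and "S \<subseteq> V"
  shows "card V * card {g \<in> automorphisms V E. g x \<in> S} = card S * card (automorphisms V E)"
proof -
  \<comment> \<open>The stabilizer of \<open>x\<close> serves as the reference: every
    \<open>y\<close> is reached from \<open>x\<close> by exactly \<open>N\<close> automorphisms.
    Taking \<open>T = V\<close> below gives the whole group, of order
    \<open>card V * N\<close>.\<close>
  define N where "N = card {g \<in> automorphisms V E. g x = x}"
  have count: "card {g \<in> automorphisms V E. g x \<in> T} = card T * N" if "T \<subseteq> V" for T
  proof -
    have "finite T"
      using that assms(1) by (rule finite_subset)
    have "card {g \<in> automorphisms V E. g x = y} = N" if "y \<in> T" for y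
      unfolding N_def using that \<open>T \<subseteq> V\<close> assms
      by (intro antisym card_automorphisms_mapping_le) auto
    moreover have "{g \<in> automorphisms V E. g x \<in> T} = (\<Union>y\<in>T. {g \<in> automorphisms V E. g x = y})"
      by auto
    moreover have "card (\<Union>y\<in>T. {g \<in> automorphisms V E. g x = y})
        = (\<Sum>y\<in>T. card {g \<in> automorphisms V E. g x = y})"
      using finite_automorphisms[OF assms(1)] \<open>finite T\<close> by (intro card_UN_disjoint) auto
    ultimately show ?thesis
      by simp
  qed
  have "{g \<in> automorphisms V E. g x \<in> V} = automorphisms V E"
    using assms(3) by (auto simp: automorphisms_def graph_automorphism_def bij_betw_def)
  then show ?thesis
    using count[of V] count[OF assms(4)] by simp
qed

text \<open>Double counting of the pairs \<open>(g, c)\<close> with \<open>c\<close> in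
  \<open>C\<close> and \<open>g c\<close> in \<open>S\<close>: by \<open>g\<close>, using
  injectivity, and by \<open>c\<close>, using the count for a single vertex.\<close>

lemma sum_card_automorphic_intersections:
  assumes "finite V" and "vertex_transitive V E" and "C \<subseteq> V" and "S \<subseteq> V"
  shows "card V * (\<Sum>g\<in>automorphisms V E. card (g ` C \<inter> S))
    = card C * card S * card (automorphisms V E)"
proof -
  have fin: "finite (automorphisms V E)" "finite C"
    using assms finite_automorphisms finite_subset by blast+
  have "card (g ` C \<inter> S) = card {c \<in> C. g c \<in> S}" if "g \<in> automorphisms V E" for g
  proof -
    have "inj_on g V"
      using that by (auto simp: automorphisms_def graph_automorphism_def bij_betw_def)
    then have "inj_on g {c \<in> C. g c \<in> S}"
      using assms(3) by (auto intro: inj_on_subset)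
    moreover have "g ` C \<inter> S = g ` {c \<in> C. g c \<in> S}"
      by auto
    ultimately show ?thesis
      by (simp add: card_image)
  qed
  then have "(\<Sum>g\<in>automorphisms V E. card (g ` C \<inter> S))
      = (\<Sum>g\<in>automorphisms V E. card {c \<in> C. g c \<in> S})"
    by simp
  also have "\<dots> = (\<Sum>c\<in>C. card {g \<in> automorphisms V E. g c \<in> S})"
    using fin by (intro sum_multicount_gen) auto
  finally have "card V * (\<Sum>g\<in>automorphisms V E. card (g ` C \<inter> S))
      = (\<Sum>c\<in>C. card V * card {g \<in> automorphisms V E. g c \<in> S})"
    by (simp add: sum_distrib_left)
  also have "\<dots> = (\<Sum>c\<in>C. card S * card (automorphisms V E))"
    using assms by (intro sum.cong card_automorphisms_into) auto
  finally show ?thesis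
    by simp
qed

section \<open>Cliques, stable sets and their images\<close>

lemma card_clique_Int_indep_le_1:
  assumes "clique C E" and "indep S E"
  shows "card (C \<inter> S) \<le> 1"
proof (rule ccontr)
  assume "\<not> card (C \<inter> S) \<le> 1"
  then obtain u v where "u \<in> C \<inter> S" "v \<in> C \<inter> S" "u \<noteq> v"
    by (metis One_nat_def card_le_Suc0_iff_eq card.infinite zero_le)
  then show False
    using assms by (auto simp: clique_def indep_def)
qed

lemma clique_automorphism_image:
  assumes "graph_automorphism V E g" and "C \<subseteq> V" and "clique C E"
  shows "clique (g ` C) E"
  using assms by (fastforce simp: clique_def graph_automorphism_def)

lemma maximal_clique_automorphism_image:
  assumes "graph_automorphism V E g" and "maximal_clique V E C"
  shows "maximal_clique V E (g ` C)"
proof -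
  have g: "bij_betw g V V" and C: "C \<subseteq> V" "clique C E"
    using assms by (auto simp: graph_automorphism_def maximal_clique_def)
  have "D = g ` C" if D: "D \<subseteq> V" "clique D E" "g ` C \<subseteq> D" for D
  proof -
    \<comment> \<open>A clique \<open>D\<close> above the image is pulled back to its preimage
      \<open>D'\<close>, a clique above \<open>C\<close> because \<open>g\<close> also reflects
      adjacency. Maximality of \<open>C\<close> then applies to \<open>D'\<close>.\<close>
    define D' where "D' = {v \<in> V. g v \<in> D}"
    have "clique D' E"
      unfolding clique_def
    proof (intro ballI impI)
      fix u v assume uv: "u \<in> D'" "v \<in> D'" "u \<noteq> v"
      then have "g u \<noteq> g v"
        using g by (auto simp: D'_def bij_betw_def dest: inj_onD)
      then have "{g u, g v} \<in> E"
        using uv D(2) by (auto simp: D'_def clique_def)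
      then show "{u, v} \<in> E"
        using uv assms(1) by (auto simp: D'_def graph_automorphism_def)
    qed
    moreover have "D' \<subseteq> V" "C \<subseteq> D'"
      using C(1) D(3) by (auto simp: D'_def)
    ultimately have "D' = C"
      using assms(2) by (auto simp: maximal_clique_def)
    moreover have "g ` D' = D"
      using g D(1) by (auto simp: D'_def bij_betw_def)
    ultimately show ?thesis
      by simp
  qed
  then show ?thesis
    using g C clique_automorphism_image[OF assms(1) C]
    by (auto simp: maximal_clique_def bij_betw_def)
qed

text \<open>A clique of largest cardinality is also maximal under inclusion, so
  \<open>clique_number\<close> is attained by a maximal clique.\<close>

lemma ex_maximal_clique_card_clique_number:
  assumes "finite V"
  obtains C where "maximal_clique V E C" "card C = clique_number V E"
proof -
  let ?F = "{C. C \<subseteq> V \<and> clique C E}"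
  have fin: "finite ?F"
    using assms by simp
  have "{} \<in> ?F"
    by (simp add: clique_def)
  then have "clique_number V E \<in> card ` ?F"
    unfolding clique_number_def using fin by (intro Max_in) auto
  then obtain C where C: "C \<in> ?F" "card C = clique_number V E"
    by auto
  have "D = C" if D: "D \<subseteq> V" "clique D E" "C \<subseteq> D" for D
  proof -
    have "card D \<le> card C"
      unfolding C(2) clique_number_def using D fin by (intro Max_ge) auto
    then show ?thesis
      using D assms by (metis card_seteq finite_subset)
  qed
  with C that show ?thesis
    by (auto simp: maximal_clique_def)
qed

lemma ex_maximal_stable_set_card_stability_number:
  assumes "finite V"
  obtains S where "maximal_stable_set V E S" "card S = stability_number V E"
proof -
  let ?F = "{S. S \<subseteq> V \<and> indep S E}"
  have fin: "finite ?F"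
    using assms by simp
  have "{} \<in> ?F"
    by (simp add: indep_def)
  then have "stability_number V E \<in> card ` ?F"
    unfolding stability_number_def using fin by (intro Max_in) auto
  then obtain S where S: "S \<in> ?F" "card S = stability_number V E"
    by auto
  have "T = S" if T: "T \<subseteq> V" "indep T E" "S \<subseteq> T" for T
  proof -
    have "card T \<le> card S"
      unfolding S(2) stability_number_def using T fin by (intro Max_ge) auto
    then show ?thesis
      using T assms by (metis card_seteq finite_subset)
  qed
  with S that show ?thesis
    by (auto simp: maximal_stable_set_def)
qed

section \<open>The product of the sizes and non-empty intersections\<close>

text \<open>Each image of \<open>C\<close> is again a maximal clique, so CIS makes every term of the
  averaged sum exactly 1. The order of the group then cancels.\<close>

lemma CIS_imp_card_mult_eq:
  assumes "finite V" and "vertex_transitive V E" and "CIS V E"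
    and "maximal_stable_set V E S" and "maximal_clique V E C"
  shows "card S * card C = card V"
proof -
  let ?A = "automorphisms V E"
  have CS: "C \<subseteq> V" "S \<subseteq> V" "indep S E"
    using assms by (auto simp: maximal_clique_def maximal_stable_set_def)
  have "card (g ` C \<inter> S) = 1" if "g \<in> ?A" for g
  proof -
    have max: "maximal_clique V E (g ` C)"
      using that assms(5) by (auto simp: automorphisms_def intro: maximal_clique_automorphism_image)
    then have "g ` C \<inter> S \<noteq> {}"
      using assms(3,4) by (auto simp: CIS_def)
    moreover have "finite (g ` C \<inter> S)"
      using CS assms(1) by (auto intro: finite_subset)
    ultimately have "0 < card (g ` C \<inter> S)"
      by (simp add: card_gt_0_iff)
    moreover have "card (g ` C \<inter> S) \<le> 1"
      using max CS by (intro card_clique_Int_indep_le_1[where E = E]) (auto simp: maximal_clique_def)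
    ultimately show ?thesis
      by simp
  qed
  then have "card V * card ?A = card C * card S * card ?A"
    using sum_card_automorphic_intersections[OF assms(1,2) CS(1,2)] by simp
  moreover have "card ?A \<noteq> 0"
    using finite_automorphisms[OF assms(1), of E] id_in_automorphisms[of V E] by auto
  ultimately show ?thesis
    by simp
qed

text \<open>The hypothesis on the product makes the average intersection size 1, while no term
  exceeds 1. A single empty intersection would push the average below 1.\<close>

lemma clique_Int_indep_nonempty:
  assumes "finite V" "V \<noteq> {}" and "vertex_transitive V E"
    and "C \<subseteq> V" "clique C E" and "S \<subseteq> V" "indep S E"
    and "card S * card C = card V"
  shows "S \<inter> C \<noteq> {}"
proof
  let ?A = "automorphisms V E"
  assume "S \<inter> C = {}"
  \<comment> \<open>The identity leaves \<open>C\<close> in place, so it is the term that makes the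
    inequality of sums strict.\<close>
  then have "restrict id V ` C \<inter> S = {}"
    using assms(4) by auto
  moreover have "card (g ` C \<inter> S) \<le> 1" if "g \<in> ?A" for g
    using that assms
    by (intro card_clique_Int_indep_le_1[where E = E] clique_automorphism_image[where V = V])
      (auto simp: automorphisms_def)
  ultimately have "(\<Sum>g\<in>?A. card (g ` C \<inter> S)) < (\<Sum>g\<in>?A. 1)"
    using finite_automorphisms[OF assms(1)] id_in_automorphisms[of V E]
    by (intro sum_strict_mono_ex1 bexI[of _ "restrict id V"]) auto
  moreover have "card V * (\<Sum>g\<in>?A. card (g ` C \<inter> S)) = card V * card ?A"
    using sum_card_automorphic_intersections[OF assms(1,3,4,6)] assms(8)
    by (simp add: mult.commute)
  ultimately show False
    using assms(1,2) by simp
qed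

theorem theorem3p1:
  fixes V :: "'a set" and E :: "'a set set" and n :: nat
  assumes "simple_graph V E"
    and "vertex_transitive V E"
    and "card V = n"
  shows "CIS V E \<longleftrightarrow>
    (\<forall>S. maximal_stable_set V E S \<longrightarrow> card S = stability_number V E) \<and>
    (\<forall>C. maximal_clique V E C \<longrightarrow> card C = clique_number V E) \<and>
    stability_number V E * clique_number V E = n"
    (is "_ \<longleftrightarrow> ?sizes")
proof
  have V: "finite V" "V \<noteq> {}"
    using assms(1) by (auto simp: simple_graph_def)
  then have "n \<noteq> 0"
    using assms(3) by auto
  show ?sizes if "CIS V E"
  proof -
    have prod: "card S * card C = n" if "maximal_stable_set V E S" "maximal_clique V E C" for S C
      using CIS_imp_card_mult_eq[OF V(1) assms(2) \<open>CIS V E\<close> that] assms(3) by simp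
    obtain C where C: "maximal_clique V E C" "card C = clique_number V E"
      using ex_maximal_clique_card_clique_number[OF V(1)] .
    obtain S where S: "maximal_stable_set V E S" "card S = stability_number V E"
      using ex_maximal_stable_set_card_stability_number[OF V(1)] .
    have SC: "stability_number V E * clique_number V E = n"
      using prod[OF S(1) C(1)] S(2) C(2) by simp
    with \<open>n \<noteq> 0\<close> have pos: "stability_number V E \<noteq> 0" "clique_number V E \<noteq> 0"
      by auto
    \<comment> \<open>Pairing \<open>T\<close> with the maximum clique \<open>C\<close> gives the
      same product \<open>n\<close> as pairing \<open>S\<close> with it, and the non-zero factor
      cancels.\<close>
    have "card T = stability_number V E" if "maximal_stable_set V E T" for T
      using prod[OF that C(1)] C(2) SC pos by (metis mult_right_cancel)
    moreover have "card D = clique_number V E" if "maximal_clique V E D" for D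
      using prod[OF S(1) that] S(2) SC pos by (metis mult_left_cancel)
    ultimately show ?thesis
      using SC by blast
  qed
  show "CIS V E" if ?sizes
    unfolding CIS_def
  proof (intro allI impI, elim conjE)
    fix S C assume "maximal_stable_set V E S" "maximal_clique V E C"
    then show "S \<inter> C \<noteq> {}"
      using that assms V
      by (intro clique_Int_indep_nonempty) (auto simp: maximal_stable_set_def maximal_clique_def)
  qed
qed

end
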